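(* Let $p$ be a prime, $n,m\ge1$, $\pi\in\mathrm{Rat}_n^p$ and $\gamma\in\mathrm{Rat}_m^p$. If $H_{\mathbb{R}}(\pi)=H_{\mathbb{R}}(\gamma)$, then $H_p(\pi)=H_p(\gamma)$.
   Context: $\mathrm{Rat}_n^p$ is the set of real probability distributions $\pi=(\pi_1,\dots,\pi_n)$ (nonnegative, summing to 1) in which each $\pi_i$ is a rational number expressible as a fraction whose denominator is not divisible by $p$; such $\pi$ thus determines an element of $\Pi_n=\{(\pi_i)\in(\mathbb{Z}/p\mathbb{Z})^n:\sum\pi_i=1\}$. $H_{\mathbb{R}}(\pi)=-\sum_{i:\pi_i\neq0}\pi_i\log\pi_i$ is Shannon entropy. For $\pi\in\Pi_n$, $H_p(\pi)=\frac1p\bigl(1-\sum_i a_i^p\bigr)\in\mathbb{Z}/p\mathbb{Z}$ where $a_i\in\mathbb{Z}$ represents $\pi_i$ mod $p$ (independent of choices). *)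

theory Defs
  imports Complex_Main "HOL-Number_Theory.Number_Theory"
begin

text \<open>
  An \<open>n\<close>-tuple is a function on \<open>nat\<close> of which only the values at \<open>1, \<dots>, n\<close> matter.
  Elements of \<open>\<int>/p\<int>\<close> are represented by the integers \<open>0, \<dots>, p - 1\<close>, so that equality in
  \<open>\<int>/p\<int>\<close> is equality of integers.
\<close>

text \<open>Since \<open>p dvd 0\<close>, the side condition below also forces \<open>b \<noteq> 0\<close>.\<close>

definition frac_rep :: "nat \<Rightarrow> real \<Rightarrow> int \<Rightarrow> int \<Rightarrow> bool" where
  "frac_rep p x a b \<longleftrightarrow> x = of_int a / of_int b \<and> \<not> int p dvd b"

definition Rat_dist :: "nat \<Rightarrow> nat \<Rightarrow> (nat \<Rightarrow> real) set" where
  "Rat_dist p n = {\<pi>. (\<forall>i\<in>{1..n}. 0 \<le> \<pi> i \<and> (\<exists>a b. frac_rep p (\<pi> i) a b)) \<and> (\<Sum>i=1..n. \<pi> i) = 1}"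

definition Pi_mod :: "nat \<Rightarrow> nat \<Rightarrow> (nat \<Rightarrow> int) set" where
  "Pi_mod p n = {\<pi>. (\<forall>i\<in>{1..n}. \<pi> i \<in> {0..<int p}) \<and> [(\<Sum>i=1..n. \<pi> i) = 1] (mod int p)}"

text \<open>The class of \<open>a / b\<close> is the element \<open>c\<close> of \<open>\<int>/p\<int>\<close> with \<open>c b = a\<close> there.\<close>

definition residue_of :: "nat \<Rightarrow> real \<Rightarrow> int" where
  "residue_of p x =
     (THE c. c \<in> {0..<int p} \<and> (\<exists>a b. frac_rep p x a b \<and> [c * b = a] (mod int p)))"

definition reduce :: "nat \<Rightarrow> (nat \<Rightarrow> real) \<Rightarrow> nat \<Rightarrow> int" where
  "reduce p \<pi> = (\<lambda>i. residue_of p (\<pi> i))"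

definition H_real :: "nat \<Rightarrow> (nat \<Rightarrow> real) \<Rightarrow> real" where
  "H_real n \<pi> = - (\<Sum>i\<in>{i\<in>{1..n}. \<pi> i \<noteq> 0}. \<pi> i * ln (\<pi> i))"

text \<open>
  The integers \<open>\<pi> i\<close> themselves serve as representatives. On \<open>Pi_mod p n\<close> the division is exact and
  any other representatives give the same value: see \<open>H_mod_dvd\<close> and \<open>H_mod_representatives\<close>.
\<close>

definition H_mod :: "nat \<Rightarrow> nat \<Rightarrow> (nat \<Rightarrow> int) \<Rightarrow> int" where
  "H_mod p n \<pi> = ((1 - (\<Sum>i=1..n. \<pi> i ^ p)) div int p) mod int p"

lemma frac_rep_coprime:
  assumes "prime p" "frac_rep p x a b"
  shows "coprime b (int p)"
proof -
  have "prime (int p)" using assms(1) by simp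
  moreover have "\<not> int p dvd b" using assms(2) by (simp add: frac_rep_def)
  ultimately have "coprime (int p) b" by (rule prime_imp_coprime)
  then show ?thesis by (simp add: coprime_commute)
qed

lemma residue_of_eq:
  assumes "prime p" "frac_rep p x a b" "c \<in> {0..<int p}" "[c * b = a] (mod int p)"
  shows "residue_of p x = c"
  unfolding residue_of_def
proof (rule the_equality)
  show "c \<in> {0..<int p} \<and> (\<exists>a b. frac_rep p x a b \<and> [c * b = a] (mod int p))"
    using assms by blast
next
  fix c' assume "c' \<in> {0..<int p} \<and> (\<exists>a b. frac_rep p x a b \<and> [c' * b = a] (mod int p))"
  then obtain a' b' where c': "c' \<in> {0..<int p}" "frac_rep p x a' b'" "[c' * b' = a'] (mod int p)"
    by blast
  have nz: "b \<noteq> 0" "b' \<noteq> 0" using assms(2) c'(2) by (auto simp: frac_rep_def)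
  have "real_of_int a / of_int b = of_int a' / of_int b'"
    using assms(2) c'(2) by (simp add: frac_rep_def)
  then have "real_of_int (a * b') = of_int (a' * b)" using nz by (simp add: field_simps)
  then have ab: "a * b' = a' * b" by linarith
  have "[c * b * b' = a * b'] (mod int p)" using assms(4) by (rule cong_scalar_right)
  moreover have "[c' * b' * b = a' * b] (mod int p)" using c'(3) by (rule cong_scalar_right)
  ultimately have "[c' * (b * b') = c * (b * b')] (mod int p)"
    using ab by (metis cong_sym cong_trans mult.assoc mult.commute)
  moreover have "coprime (b * b') (int p)"
    using frac_rep_coprime[OF assms(1,2)] frac_rep_coprime[OF assms(1) c'(2)] by simp
  ultimately have "[c' = c] (mod int p)" by (simp add: cong_mult_rcancel)
  then show "c' = c" using c'(1) assms(3) by (auto simp: cong_def)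
qed

lemma residue_of_frac:
  assumes "prime p" "frac_rep p x a b"
  shows "residue_of p x \<in> {0..<int p}" "[residue_of p x * b = a] (mod int p)"
proof -
  have "coprime b (int p)"
    using frac_rep_coprime[OF assms] .
  then obtain d where d: "[b * d = 1] (mod int p)" using cong_solve_coprime_int by blast
  define c where "c = (d * a) mod int p"
  have "int p > 0" using assms(1) prime_gt_0_nat by simp
  then have c: "c \<in> {0..<int p}" by (simp add: c_def)
  have "[c * b = d * a * b] (mod int p)"
    unfolding c_def cong_def by (simp add: mod_mult_left_eq)
  also have "[d * a * b = a] (mod int p)"
    using cong_scalar_right[OF d, of a] by (simp add: mult_ac)
  finally have cb: "[c * b = a] (mod int p)" .
  have "residue_of p x = c" using residue_of_eq[OF assms c cb] .
  with c cb show "residue_of p x \<in> {0..<int p}" "[residue_of p x * b = a] (mod int p)" by auto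
qed

lemma reduce_in_Pi_mod:
  assumes "prime p" "\<pi> \<in> Rat_dist p n"
  shows "reduce p \<pi> \<in> Pi_mod p n"
proof -
  have "\<forall>i\<in>{1..n}. \<exists>a b. frac_rep p (\<pi> i) a b" and s: "(\<Sum>i=1..n. \<pi> i) = 1"
    using assms(2) by (auto simp: Rat_dist_def)
  then obtain a b where ab: "\<And>i. i \<in> {1..n} \<Longrightarrow> frac_rep p (\<pi> i) (a i) (b i)" by metis
  define B where "B = (\<Prod>i=1..n. b i)"
  define e where "e i = (\<Prod>j\<in>{1..n}-{i}. b j)" for i
  have B: "B = b i * e i" if "i \<in> {1..n}" for i
    unfolding B_def e_def using that by (simp add: prod.remove)
  have cop: "coprime B (int p)" unfolding B_def
    using ab frac_rep_coprime[OF assms(1)] by (blast intro: prod_coprime_left)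
  have "real_of_int B = (\<Sum>i=1..n. \<pi> i * of_int B)"
    using s by (simp flip: sum_distrib_right)
  also have "\<dots> = (\<Sum>i=1..n. of_int (a i * e i))"
  proof (rule sum.cong[OF refl])
    fix i assume i: "i \<in> {1..n}"
    have "b i \<noteq> 0" using ab[OF i] by (auto simp: frac_rep_def)
    then show "\<pi> i * of_int B = of_int (a i * e i)"
      using ab[OF i] by (simp add: B[OF i] frac_rep_def)
  qed
  also have "\<dots> = of_int (\<Sum>i=1..n. a i * e i)" by simp
  finally have BS: "B = (\<Sum>i=1..n. a i * e i)" by linarith
  have "[(\<Sum>i=1..n. residue_of p (\<pi> i) * B) = (\<Sum>i=1..n. a i * e i)] (mod int p)"
  proof (rule cong_sum)
    fix i assume i: "i \<in> {1..n}"
    show "[residue_of p (\<pi> i) * B = a i * e i] (mod int p)"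
      using cong_scalar_right[OF residue_of_frac(2)[OF assms(1) ab[OF i]], of "e i"]
      by (simp add: B[OF i] mult.assoc)
  qed
  then have "[(\<Sum>i=1..n. residue_of p (\<pi> i)) * B = 1 * B] (mod int p)"
    using BS by (simp add: sum_distrib_right)
  then have "[(\<Sum>i=1..n. residue_of p (\<pi> i)) = 1] (mod int p)"
    using cop cong_mult_rcancel by blast
  moreover have "\<forall>i\<in>{1..n}. residue_of p (\<pi> i) \<in> {0..<int p}"
    using residue_of_frac(1)[OF assms(1)] ab by blast
  ultimately show ?thesis by (simp add: Pi_mod_def reduce_def)
qed

lemma fermat_int:
  assumes "prime p" shows "[(a::int) ^ p = a] (mod int p)"
proof -
  define k where "k = nat (a mod int p)"
  have p0: "p > 0" using assms prime_gt_0_nat by blast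
  have k: "[a = int k] (mod int p)" using p0 by (simp add: k_def cong_def)
  have "[k ^ p = k] (mod p)"
  proof (cases "p dvd k")
    case True
    then have "p dvd k ^ p" using p0 by (meson dvd_power dvd_trans dvd_power_same)
    with True show ?thesis by (simp add: cong_def)
  next
    case False
    have "[k ^ (p - 1) * k = 1 * k] (mod p)"
      using fermat_theorem[OF assms False] by (rule cong_scalar_right)
    then show ?thesis using p0 by (metis mult_1 power_minus_mult)
  qed
  then have "[int k ^ p = int k] (mod int p)"
    by (metis cong_int_iff of_nat_power)
  with k show ?thesis by (meson cong_pow cong_sym cong_trans)
qed

lemma H_mod_dvd:
  assumes "prime p" "\<pi> \<in> Pi_mod p n" "\<And>i. i \<in> {1..n} \<Longrightarrow> [a i = \<pi> i] (mod int p)"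
  shows "int p dvd 1 - (\<Sum>i=1..n. a i ^ p)"
proof -
  have "[(\<Sum>i=1..n. a i ^ p) = (\<Sum>i=1..n. \<pi> i)] (mod int p)"
    using assms(3) fermat_int[OF assms(1)] by (intro cong_sum) (blast intro: cong_trans)
  also have "[(\<Sum>i=1..n. \<pi> i) = 1] (mod int p)" using assms(2) by (simp add: Pi_mod_def)
  finally show ?thesis by (metis cong_iff_dvd_diff cong_sym)
qed

lemma cong_pow_prime_square:
  assumes "prime p" "[(a::int) = b] (mod int p)"
  shows "[a ^ p = b ^ p] (mod (int p)\<^sup>2)"
proof -
  have "[(\<Sum>i<p. b ^ (p - Suc i) * a ^ i) = (\<Sum>i<p. a ^ (p - Suc i) * a ^ i)] (mod int p)"
    using assms(2) by (intro cong_sum cong_mult cong_pow cong_refl) (rule cong_sym)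
  also have "(\<Sum>i<p. a ^ (p - Suc i) * a ^ i) = (\<Sum>i<p. a ^ (p - 1))"
    by (intro sum.cong refl) (simp flip: power_add)
  also have "[\<dots> = 0] (mod int p)" by (simp add: cong_def)
  finally have "int p dvd (\<Sum>i<p. b ^ (p - Suc i) * a ^ i)" by (simp add: cong_0_iff)
  moreover have "int p dvd a - b" using assms(2) by (simp add: cong_iff_dvd_diff)
  moreover have "a ^ p - b ^ p = (a - b) * (\<Sum>i<p. b ^ (p - Suc i) * a ^ i)"
    by (rule power_diff_sumr2)
  ultimately show ?thesis by (simp add: cong_iff_dvd_diff power2_eq_square mult_dvd_mono)
qed

lemma H_mod_representatives:
  assumes "prime p" "\<pi> \<in> Pi_mod p n" "\<And>i. i \<in> {1..n} \<Longrightarrow> [a i = \<pi> i] (mod int p)"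
  shows "H_mod p n \<pi> = ((1 - (\<Sum>i=1..n. a i ^ p)) div int p) mod int p"
proof -
  define S where "S = 1 - (\<Sum>i=1..n. \<pi> i ^ p)"
  define T where "T = 1 - (\<Sum>i=1..n. a i ^ p)"
  have p0: "int p > 0" using assms(1) prime_gt_0_nat by simp
  have "int p dvd T" unfolding T_def using H_mod_dvd[OF assms] .
  moreover have "int p dvd S" unfolding S_def using H_mod_dvd[OF assms(1,2)] by simp
  ultimately obtain s t where st: "S = int p * s" "T = int p * t" by (auto elim!: dvdE)
  have "[S = T] (mod (int p)\<^sup>2)" unfolding S_def T_def
    using assms(3) by (intro cong_diff cong_refl cong_sum)
      (blast intro: cong_pow_prime_square[OF assms(1)] cong_sym)
  then have "int p * int p dvd int p * (s - t)"
    by (simp add: st cong_iff_dvd_diff power2_eq_square right_diff_distrib)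
  then have "int p dvd s - t" using p0 by simp
  then have "s mod int p = t mod int p" by (simp add: mod_eq_dvd_iff)
  then have "S div int p mod int p = T div int p mod int p" using p0 st by simp
  then show ?thesis unfolding H_mod_def S_def T_def .
qed

end

theory Submission
  imports Defs
begin

text \<open>
  Write both distributions over one common denominator \<open>B\<close> prime to \<open>p\<close>, as \<open>\<pi>\<^sub>i = k\<^sub>i / B\<close> and
  \<open>\<gamma>\<^sub>j = l\<^sub>j / B\<close>. Equality of the real entropies says that the integers \<open>\<Prod> k\<^sub>i ^ k\<^sub>i\<close> and
  \<open>\<Prod> l\<^sub>j ^ l\<^sub>j\<close> coincide. For \<open>a = p ^ v u\<close> with \<open>u\<close> prime to \<open>p\<close>, put
  \<open>F a = u ^ (p - 1) - 1 - v\<close>. Modulo \<open>p\<^sup>2\<close> this is a logarithm, \<open>F (a b) = F a + F b\<close>, and it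
  satisfies \<open>a F a = a ^ p - a\<close>. Hence \<open>\<Sum> k\<^sub>i ^ p = F (\<Prod> k\<^sub>i ^ k\<^sub>i) + B\<close> modulo \<open>p\<^sup>2\<close>, so that
  \<open>\<Sum> k\<^sub>i ^ p\<close> and \<open>\<Sum> l\<^sub>j ^ p\<close> agree modulo \<open>p\<^sup>2\<close>, and so do \<open>\<Sum> \<pi>\<^sub>i ^ p\<close> and \<open>\<Sum> \<gamma>\<^sub>j ^ p\<close>.
\<close>

section \<open>The Fermat quotient as a logarithm modulo \<open>p\<^sup>2\<close>\<close>

definition fermat_log :: "nat \<Rightarrow> nat \<Rightarrow> int" where
  "fermat_log p a =
     int (a div p ^ multiplicity p a) ^ (p - 1) - 1 - int (multiplicity p a)"

lemma fermat_log_eq: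
  assumes "prime p" "\<not> p dvd u"
  shows "fermat_log p (p ^ v * u) = int u ^ (p - 1) - 1 - int v"
proof -
  have "multiplicity p (p ^ v * u) = v"
    using assms by (intro multiplicity_eqI) auto
  then show ?thesis
    using assms prime_gt_0_nat[of p] by (simp add: fermat_log_def)
qed

lemma prime_power_times_unit:
  assumes "prime p" "(a::nat) > 0"
  obtains v u where "a = p ^ v * u" "\<not> p dvd u"
proof -
  have "a \<noteq> 0" "\<not> is_unit p" using assms not_prime_unit by auto
  then show ?thesis using that multiplicity_decompose' by metis
qed

lemma fermat_log_1: "prime p \<Longrightarrow> fermat_log p 1 = 0"
  using fermat_log_eq[of p 1 0] by (auto simp: prime_nat_iff)

lemma fermat_dvd:
  assumes "prime p" "\<not> p dvd a"
  shows "int p dvd int a ^ (p - 1) - 1"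
  using fermat_theorem[OF assms]
  by (metis cong_iff_dvd_diff cong_int_iff of_nat_1 of_nat_power)

text \<open>Multiplicities add exactly, and with \<open>x = u ^ (p - 1)\<close>,
  \<open>y = t ^ (p - 1)\<close> for the parts \<open>u\<close>, \<open>t\<close> prime to
  \<open>p\<close> the defect is \<open>(x - 1) * (y - 1)\<close>. Fermat's little theorem makes
  both factors divisible by \<open>p\<close>.\<close>

lemma fermat_log_mult:
  assumes "prime p" "a > 0" "b > 0"
  shows "[fermat_log p (a * b) = fermat_log p a + fermat_log p b] (mod (int p)\<^sup>2)"
proof -
  obtain v u where a: "a = p ^ v * u" "\<not> p dvd u"
    using assms prime_power_times_unit by blast
  obtain w t where b: "b = p ^ w * t" "\<not> p dvd t"
    using assms prime_power_times_unit by blast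
  have ut: "\<not> p dvd u * t" using a b assms(1) by (simp add: prime_dvd_mult_iff)
  have "a * b = p ^ (v + w) * (u * t)" by (simp add: a b power_add)
  then have "fermat_log p (a * b) = (int u * int t) ^ (p - 1) - 1 - int (v + w)"
    using fermat_log_eq[OF assms(1) ut] by simp
  then have "fermat_log p (a * b) - (fermat_log p a + fermat_log p b)
      = (int u ^ (p - 1) - 1) * (int t ^ (p - 1) - 1)"
    using fermat_log_eq[OF assms(1) a(2), of v] fermat_log_eq[OF assms(1) b(2), of w]
    unfolding a(1)[symmetric] b(1)[symmetric] by (simp add: power_mult_distrib algebra_simps)
  then show ?thesis
    using fermat_dvd[OF assms(1) a(2)] fermat_dvd[OF assms(1) b(2)]
    by (simp add: cong_iff_dvd_diff power2_eq_square mult_dvd_mono)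
qed

lemma fermat_log_power:
  assumes "prime p" "a > 0"
  shows "[fermat_log p (a ^ k) = int k * fermat_log p a] (mod (int p)\<^sup>2)"
proof (induction k)
  case 0
  show ?case using fermat_log_1[OF assms(1)] by simp
next
  case (Suc k)
  have "[fermat_log p (a * a ^ k) = fermat_log p a + fermat_log p (a ^ k)] (mod (int p)\<^sup>2)"
    using assms by (intro fermat_log_mult) auto
  also have "[fermat_log p a + fermat_log p (a ^ k)
      = fermat_log p a + int k * fermat_log p a] (mod (int p)\<^sup>2)"
    by (intro cong_add cong_refl Suc.IH)
  finally show ?case by (simp add: algebra_simps)
qed

lemma fermat_log_prod:
  assumes "prime p" "finite A" "\<And>i. i \<in> A \<Longrightarrow> f i > 0"
  shows "[fermat_log p (\<Prod>i\<in>A. f i) = (\<Sum>i\<in>A. fermat_log p (f i))] (mod (int p)\<^sup>2)"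
  using assms(2,3)
proof (induction A rule: finite_induct)
  case empty
  show ?case using fermat_log_1[OF assms(1)] by simp
next
  case (insert x A)
  have "[fermat_log p (f x * prod f A) = fermat_log p (f x) + fermat_log p (prod f A)]
      (mod (int p)\<^sup>2)"
    using insert.prems by (intro fermat_log_mult[OF assms(1)] prod_pos) auto
  also have "[fermat_log p (f x) + fermat_log p (prod f A)
      = fermat_log p (f x) + (\<Sum>i\<in>A. fermat_log p (f i))] (mod (int p)\<^sup>2)"
    using insert by (intro cong_add cong_refl) auto
  finally show ?case using insert by simp
qed

text \<open>If \<open>p\<close> does not divide \<open>a\<close>, both sides are equal as integers.
  Otherwise \<open>a ^ p\<close> vanishes modulo \<open>p\<^sup>2\<close>, and so does
  \<open>a * (u ^ (p - 1) - 1)\<close>, whose two factors are multiples of \<open>p\<close>. What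
  remains is \<open>a * (1 - v)\<close>, and the term \<open>- v\<close> of
  \<open>fermat_log\<close> makes this vanish too: \<open>v = 1\<close> gives 0, and
  \<open>v \<ge> 2\<close> gives \<open>p\<^sup>2\<close> dividing \<open>a\<close>.\<close>

lemma times_fermat_log:
  assumes "prime p" "a > 0"
  shows "[int a * fermat_log p a = int a ^ p - int a] (mod (int p)\<^sup>2)"
proof -
  obtain v u where a: "a = p ^ v * u" "\<not> p dvd u"
    using assms prime_power_times_unit by blast
  have F: "fermat_log p a = int u ^ (p - 1) - 1 - int v"
    using fermat_log_eq[OF assms(1) a(2)] a(1) by simp
  have p2: "p \<ge> 2" using assms(1) by (rule prime_ge_2_nat)
  show ?thesis
  proof (cases "v = 0")
    case True
    have "int a * int a ^ (p - 1) = int a ^ p"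
      using p2 by (simp flip: power_Suc)
    moreover have "u = a" using True a(1) by simp
    ultimately have "int a * fermat_log p a = int a ^ p - int a"
      using True F by (simp add: right_diff_distrib)
    then show ?thesis by simp
  next
    case False
    have pa: "int p dvd int a" using False by (simp add: a(1))
    with fermat_dvd[OF assms(1) a(2)] have 1: "(int p)\<^sup>2 dvd int a * (int u ^ (p - 1) - 1)"
      by (simp add: power2_eq_square mult_dvd_mono)
    have 2: "(int p)\<^sup>2 dvd int a ^ p"
      using dvd_power_same[OF pa, of 2] le_imp_power_dvd[OF p2, of "int a"] by (rule dvd_trans)
    have 3: "(int p)\<^sup>2 dvd int a * (1 - int v)"
    proof (cases "v = 1")
      case False
      with \<open>v \<noteq> 0\<close> have "(int p)\<^sup>2 dvd int p ^ v" by (intro le_imp_power_dvd) auto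
      then show ?thesis by (simp add: a(1))
    qed simp
    have "int a * fermat_log p a - (int a ^ p - int a)
        = int a * (int u ^ (p - 1) - 1) + int a * (1 - int v) - int a ^ p"
      by (simp add: F algebra_simps)
    then show ?thesis unfolding cong_iff_dvd_diff using 1 2 3 by (metis dvd_add dvd_diff)
  qed
qed

lemma sum_prime_powers_cong:
  assumes "prime p" "finite A"
  shows "[(\<Sum>i\<in>A. int (k i) ^ p) = fermat_log p (\<Prod>i\<in>A. k i ^ k i) + int (\<Sum>i\<in>A. k i)]
    (mod (int p)\<^sup>2)"
proof -
  have term_cong: "[fermat_log p (k i ^ k i) = int (k i) ^ p - int (k i)] (mod (int p)\<^sup>2)" for i
  proof (cases "k i = 0")
    \<comment> \<open>Since \<open>0 ^ 0 = 1\<close>, a zero numerator contributes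
      \<open>fermat_log p 1 = 0\<close>, which matches \<open>0 ^ p - 0\<close>.\<close>
    case True
    then show ?thesis using fermat_log_1[OF assms(1)] prime_gt_0_nat[OF assms(1)]
      by (simp add: power_0_left)
  next
    case False
    then show ?thesis
      using fermat_log_power[OF assms(1)] times_fermat_log[OF assms(1)] by (blast intro: cong_trans)
  qed
  have "[fermat_log p (\<Prod>i\<in>A. k i ^ k i) = (\<Sum>i\<in>A. fermat_log p (k i ^ k i))] (mod (int p)\<^sup>2)"
    using assms by (intro fermat_log_prod) auto
  also have "[(\<Sum>i\<in>A. fermat_log p (k i ^ k i)) = (\<Sum>i\<in>A. int (k i) ^ p - int (k i))]
      (mod (int p)\<^sup>2)"
    by (intro cong_sum term_cong)
  finally have "[fermat_log p (\<Prod>i\<in>A. k i ^ k i) + int (\<Sum>i\<in>A. k i)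
      = (\<Sum>i\<in>A. int (k i) ^ p - int (k i)) + int (\<Sum>i\<in>A. k i)] (mod (int p)\<^sup>2)"
    by (intro cong_add cong_refl)
  then show ?thesis by (simp add: sum_subtractf cong_sym)
qed

section \<open>Common denominators and the real entropy\<close>

lemma Rat_dist_common_denominator:
  assumes "prime p" "\<pi> \<in> Rat_dist p n"
  obtains B k where "\<not> p dvd B" "\<And>i. i \<in> {1..n} \<Longrightarrow> \<pi> i = real (k i) / real B"
proof -
  have "\<forall>i\<in>{1..n}. \<exists>a b. frac_rep p (\<pi> i) a b" and pos: "\<And>i. i \<in> {1..n} \<Longrightarrow> \<pi> i \<ge> 0"
    using assms(2) by (auto simp: Rat_dist_def)
  then obtain a b where ab: "\<And>i. i \<in> {1..n} \<Longrightarrow> frac_rep p (\<pi> i) (a i) (b i)" by metis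
  \<comment> \<open>Absolute values are taken because \<open>frac_rep\<close> allows negative
    denominators; as \<open>p\<close> is prime, the product stays prime to \<open>p\<close>.\<close>
  define B where "B = (\<Prod>i=1..n. nat \<bar>b i\<bar>)"
  have "\<not> p dvd nat \<bar>b i\<bar>" if "i \<in> {1..n}" for i
    using ab[OF that] by (simp add: frac_rep_def flip: int_dvd_int_iff)
  then have B: "\<not> p dvd B"
    unfolding B_def using assms(1) by (auto simp: prime_dvd_prod_iff)
  then have B0: "B \<noteq> 0" by (metis dvd_0_right)
  have "\<exists>k. \<pi> i = real k / real B" if i: "i \<in> {1..n}" for i
  proof -
    have "nat \<bar>b i\<bar> dvd B" unfolding B_def using i by (intro dvd_prodI) auto
    then have "b i dvd int B" by (metis abs_dvd_iff abs_ge_zero int_dvd_int_iff nat_0_le)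
    then obtain c where c: "int B = b i * c" by blast
    have "b i \<noteq> 0" using ab[OF i] by (auto simp: frac_rep_def)
    then have eq: "\<pi> i * real B = real_of_int (a i * c)"
      using ab[OF i] arg_cong[OF c, of real_of_int] by (simp add: frac_rep_def)
    then have "real_of_int (a i * c) \<ge> 0" using pos[OF i] by (metis mult_nonneg_nonneg of_nat_0_le_iff)
    then have "a i * c \<ge> 0" by linarith
    then have "\<pi> i * real B = real (nat (a i * c))" using eq by (metis nat_0_le of_int_of_nat_eq)
    then show ?thesis using B0 by (metis nonzero_mult_div_cancel_right of_nat_eq_0_iff)
  qed
  then obtain k where "\<And>i. i \<in> {1..n} \<Longrightarrow> \<pi> i = real (k i) / real B" by metis
  with B show ?thesis using that by blast
qed

lemma sum_numerators_eq:
  assumes "B > 0" "\<pi> \<in> Rat_dist p n" "\<And>i. i \<in> {1..n} \<Longrightarrow> \<pi> i = real (k i) / real B"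
  shows "(\<Sum>i=1..n. k i) = B"
proof -
  have "real (\<Sum>i=1..n. k i) = (\<Sum>i=1..n. real B * \<pi> i)"
    using assms(1,3) by simp
  also have "\<dots> = real B"
    using assms(2) by (simp add: Rat_dist_def flip: sum_distrib_left)
  finally show ?thesis by linarith
qed

text \<open>Once \<open>B\<close> is fixed, the entropy determines the integer
  \<open>\<Prod> k i ^ k i\<close>: the denominators together contribute only
  \<open>B * ln B\<close>, because the numerators sum to \<open>B\<close>.\<close>

lemma H_real_common_denominator:
  assumes "B > 0" "\<And>i. i \<in> {1..n} \<Longrightarrow> \<pi> i = real (k i) / real B" "(\<Sum>i=1..n. k i) = B"
  shows "real B * H_real n \<pi> = real B * ln (real B) - ln (real (\<Prod>i=1..n. k i ^ k i))"
proof -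
  have "H_real n \<pi> = - (\<Sum>i=1..n. \<pi> i * ln (\<pi> i))"
    unfolding H_real_def by (intro arg_cong[of _ _ uminus] sum.mono_neutral_left) auto
  then have "real B * H_real n \<pi> = - (\<Sum>i=1..n. real B * (\<pi> i * ln (\<pi> i)))"
    by (simp add: sum_distrib_left)
  also have "(\<Sum>i=1..n. real B * (\<pi> i * ln (\<pi> i)))
      = (\<Sum>i=1..n. ln (real (k i ^ k i)) - real (k i) * ln (real B))"
  proof (rule sum.cong[OF refl])
    fix i assume i: "i \<in> {1..n}"
    \<comment> \<open>For \<open>k i = 0\<close> both sides are 0, again by
      \<open>0 ^ 0 = 1\<close>.\<close>
    show "real B * (\<pi> i * ln (\<pi> i)) = ln (real (k i ^ k i)) - real (k i) * ln (real B)"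
      using assms(1) assms(2)[OF i]
      by (cases "k i = 0") (simp_all add: ln_div ln_realpow right_diff_distrib)
  qed
  also have "\<dots> = (\<Sum>i=1..n. ln (real (k i ^ k i))) - real (\<Sum>i=1..n. k i) * ln (real B)"
    by (simp add: sum_subtractf sum_distrib_right)
  also have "(\<Sum>i=1..n. ln (real (k i ^ k i))) = ln (\<Prod>i=1..n. real (k i ^ k i))"
    by (rule ln_prod[symmetric]) auto
  finally show ?thesis unfolding assms(3) by simp
qed

section \<open>From numerators to residues\<close>

lemma sum_reduce_power_cong:
  assumes "prime p" "\<not> p dvd B" "\<And>i. i \<in> {1..n} \<Longrightarrow> \<pi> i = real (k i) / real B"
  shows "[int B ^ p * (\<Sum>i=1..n. reduce p \<pi> i ^ p) = (\<Sum>i=1..n. int (k i) ^ p)] (mod (int p)\<^sup>2)"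
proof -
  have "[(\<Sum>i=1..n. (reduce p \<pi> i * int B) ^ p) = (\<Sum>i=1..n. int (k i) ^ p)] (mod (int p)\<^sup>2)"
  \<comment> \<open>The bases agree only modulo \<open>p\<close>; taking \<open>p\<close>-th powers
    lifts this to \<open>p\<^sup>2\<close>.\<close>
  proof (intro cong_sum cong_pow_prime_square assms(1))
    fix i assume "i \<in> {1..n}"
    then have "frac_rep p (\<pi> i) (int (k i)) (int B)"
      using assms(2,3) by (simp add: frac_rep_def)
    then show "[reduce p \<pi> i * int B = int (k i)] (mod int p)"
      unfolding reduce_def by (rule residue_of_frac(2)[OF assms(1)])
  qed
  then show ?thesis by (simp add: power_mult_distrib sum_distrib_left mult.commute)
qed

text \<open>Adding \<open>q * (q * c)\<close> to \<open>x\<close> shifts \<open>x div q\<close> by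
  the multiple \<open>q * c\<close> of \<open>q\<close>. Thus \<open>H_mod\<close> depends only on
  the power sum modulo \<open>p\<^sup>2\<close>.\<close>

lemma div_mod_cong_square:
  assumes "[x = y] (mod (q::int)\<^sup>2)"
  shows "x div q mod q = y div q mod q"
proof (cases "q = 0")
  case False
  obtain c where "y = x + q * (q * c)"
    using assms by (auto simp: cong_iff_lin power2_eq_square mult.assoc)
  then show ?thesis using False by simp
qed (use assms in simp)

theorem theorem7p2:
  fixes p n m :: nat and \<pi> \<gamma> :: "nat \<Rightarrow> real"
  assumes "prime p" and "n \<ge> 1" and "m \<ge> 1"
    and "\<pi> \<in> Rat_dist p n" and "\<gamma> \<in> Rat_dist p m"
    and "H_real n \<pi> = H_real m \<gamma>"
  shows "H_mod p n (reduce p \<pi>) = H_mod p m (reduce p \<gamma>)"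
proof -
  obtain C k' where C: "\<not> p dvd C" "\<And>i. i \<in> {1..n} \<Longrightarrow> \<pi> i = real (k' i) / real C"
    using Rat_dist_common_denominator[OF assms(1,4)] by blast
  obtain D l' where D: "\<not> p dvd D" "\<And>i. i \<in> {1..m} \<Longrightarrow> \<gamma> i = real (l' i) / real D"
    using Rat_dist_common_denominator[OF assms(1,5)] by blast
  \<comment> \<open>With one denominator for both distributions, the terms \<open>B * ln B\<close>
    cancel and both families of numerators have the same sum.\<close>
  define B where "B = C * D"
  define k l where "k i = k' i * D" and "l i = l' i * C" for i
  have CD0: "C \<noteq> 0" "D \<noteq> 0" using C(1) D(1) by (metis dvd_0_right)+
  then have B0: "B > 0" by (simp add: B_def)
  have pB: "\<not> p dvd B" using C(1) D(1) assms(1) by (simp add: B_def prime_dvd_mult_iff)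
  have k: "\<pi> i = real (k i) / real B" if "i \<in> {1..n}" for i
    using C(2)[OF that] CD0 by (simp add: B_def k_def)
  have l: "\<gamma> i = real (l i) / real B" if "i \<in> {1..m}" for i
    using D(2)[OF that] CD0 by (simp add: B_def l_def)
  have ksum: "(\<Sum>i=1..n. k i) = B" using sum_numerators_eq[OF B0 assms(4) k] .
  have lsum: "(\<Sum>i=1..m. l i) = B" using sum_numerators_eq[OF B0 assms(5) l] .

  have "ln (real (\<Prod>i=1..n. k i ^ k i)) = ln (real (\<Prod>i=1..m. l i ^ l i))"
    using H_real_common_denominator[OF B0 k ksum] H_real_common_denominator[OF B0 l lsum]
      assms(6) by simp
  moreover have "(\<Prod>i=1..n. k i ^ k i) > 0" "(\<Prod>i=1..m. l i ^ l i) > 0"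
    by (auto intro!: prod_pos)
  ultimately have prods: "(\<Prod>i=1..n. k i ^ k i) = (\<Prod>i=1..m. l i ^ l i)"
    by (metis ln_inj_iff of_nat_0_less_iff of_nat_eq_iff)

  \<comment> \<open>Both power sums are congruent to \<open>fermat_log\<close> of the same product
    plus the same \<open>B\<close>.\<close>
  have "[(\<Sum>i=1..n. int (k i) ^ p) = (\<Sum>i=1..m. int (l i) ^ p)] (mod (int p)\<^sup>2)"
    using sum_prime_powers_cong[OF assms(1), of "{1..n}" k]
      sum_prime_powers_cong[OF assms(1), of "{1..m}" l]
    unfolding prods ksum lsum by (simp add: cong_def)
  then have "[int B ^ p * (\<Sum>i=1..n. reduce p \<pi> i ^ p) = int B ^ p * (\<Sum>i=1..m. reduce p \<gamma> i ^ p)]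
      (mod (int p)\<^sup>2)"
    using sum_reduce_power_cong[OF assms(1) pB k] sum_reduce_power_cong[OF assms(1) pB l]
    by (simp add: cong_def)
  \<comment> \<open>So the factor \<open>B ^ p\<close> can be cancelled modulo
    \<open>p\<^sup>2\<close>.\<close>
  moreover have "coprime (int B ^ p) ((int p)\<^sup>2)"
    using prime_imp_coprime[OF assms(1) pB] by (simp add: coprime_commute)
  ultimately have "[(\<Sum>i=1..n. reduce p \<pi> i ^ p) = (\<Sum>i=1..m. reduce p \<gamma> i ^ p)] (mod (int p)\<^sup>2)"
    using cong_mult_lcancel by blast
  then have "[1 - (\<Sum>i=1..n. reduce p \<pi> i ^ p) = 1 - (\<Sum>i=1..m. reduce p \<gamma> i ^ p)]
      (mod (int p)\<^sup>2)"
    by (intro cong_diff cong_refl)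
  then show ?thesis unfolding H_mod_def by (rule div_mod_cong_square)
qed

end
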